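(* Let $n\ge 4$. The set $\mathcal{SI}(\mathcal{E}_{\lozenge_n})$ is a subsemiring of $\mathcal{E}_{\lozenge_n}$. The set $\left(\mathcal{E}^{[0,1]}_{\lozenge_n}\right)^{*}$ is an ideal of $\mathcal{SI}(\mathcal{E}_{\lozenge_n})$. The set $\mathcal{SI}(\mathcal{E}_{\lozenge_n})\setminus\{i\}$, where $i$ denotes the identity map, is a maximal ideal of $\mathcal{SI}(\mathcal{E}_{\lozenge_n})$.
   Context: A semiring is a set with a commutative associative addition and an associative multiplication satisfying both distributive laws (no zero or identity is required); a subsemiring is a nonempty subset closed under both operations; an ideal $I$ of $R$ is a nonempty subset closed under addition with $RI\subseteq I$ and $IR\subseteq I$; it is maximal if $I\ne R$ and no ideal $J$ satisfies $I\subsetneq J\subsetneq R$. For $n\ge 4$, $\lozenge_n$ is the lattice with $n$ elements $0,1,a_1,\dots,a_{n-2}$, where $0$ is the least element, $1$ is the greatest element and $a_1,\dots,a_{n-2}$ are pairwise incomparable (so $a_i\vee a_j=1$ for $i\ne j$). $\mathcal{E}_{\lozenge_n}$ is the semiring of all maps $\alpha:\lozenge_n\to\lozenge_n$ with $\alpha(x\vee y)=\alpha(x)\vee\alpha(y)$ and $\alpha(0)=0$, with operations $(\alpha+\beta)(x)=\alpha(x)\vee\beta(x)$ and $(\alpha\cdot\beta)(x)=\beta(\alpha(x))$. $\mathcal{SI}(\mathcal{E}_{\lozenge_n})$ is the set of stable idempotents: all $\alpha\in\mathcal{E}_{\lozenge_n}$ with $\alpha\cdot\alpha=\alpha$ and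 $\alpha(1)=1$. $\left(\mathcal{E}^{[0,1]}_{\lozenge_n}\right)^{*}=\{\overline{1}\}\cup\{\varphi_j:1\le j\le n-2\}$, where $\overline{1}$ sends $0$ to $0$ and every other element to $1$, and $\varphi_j\in\mathcal{E}_{\lozenge_n}$ is given by $\varphi_j(a_j)=0$, $\varphi_j(a_k)=1$ for $k\neq j$, $\varphi_j(1)=1$. *)

theory Defs
  imports "HOL-Algebra.Congruence" "HOL-Library.FuncSet"
begin

section \<open>Semirings without zero and identity\<close>

text \<open>The ring record of HOL-Algebra cannot be reused: it carries a zero and an identity, which the
  semirings considered here need not have.\<close>

record 'a semiring_struct = "'a partial_object" +
  add :: "['a, 'a] \<Rightarrow> 'a" (infixl "\<oplus>\<index>" 65)
  mult :: "['a, 'a] \<Rightarrow> 'a" (infixl "\<otimes>\<index>" 70)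

locale carrier_semiring =
  fixes R (structure)
  assumes add_closed: "\<lbrakk>x \<in> carrier R; y \<in> carrier R\<rbrakk> \<Longrightarrow> x \<oplus> y \<in> carrier R"
    and add_assoc: "\<lbrakk>x \<in> carrier R; y \<in> carrier R; z \<in> carrier R\<rbrakk> \<Longrightarrow> (x \<oplus> y) \<oplus> z = x \<oplus> (y \<oplus> z)"
    and add_comm: "\<lbrakk>x \<in> carrier R; y \<in> carrier R\<rbrakk> \<Longrightarrow> x \<oplus> y = y \<oplus> x"
    and mult_closed: "\<lbrakk>x \<in> carrier R; y \<in> carrier R\<rbrakk> \<Longrightarrow> x \<otimes> y \<in> carrier R"
    and mult_assoc: "\<lbrakk>x \<in> carrier R; y \<in> carrier R; z \<in> carrier R\<rbrakk> \<Longrightarrow> (x \<otimes> y) \<otimes> z = x \<otimes> (y \<otimes> z)"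
    and distrib_left: "\<lbrakk>x \<in> carrier R; y \<in> carrier R; z \<in> carrier R\<rbrakk> \<Longrightarrow> x \<otimes> (y \<oplus> z) = x \<otimes> y \<oplus> x \<otimes> z"
    and distrib_right: "\<lbrakk>x \<in> carrier R; y \<in> carrier R; z \<in> carrier R\<rbrakk> \<Longrightarrow> (x \<oplus> y) \<otimes> z = x \<otimes> z \<oplus> y \<otimes> z"

locale subsemiring = carrier_semiring R for S and R (structure) +
  assumes sub_subset: "S \<subseteq> carrier R"
    and sub_nonempty: "S \<noteq> {}"
    and sub_add: "\<lbrakk>x \<in> S; y \<in> S\<rbrakk> \<Longrightarrow> x \<oplus> y \<in> S"
    and sub_mult: "\<lbrakk>x \<in> S; y \<in> S\<rbrakk> \<Longrightarrow> x \<otimes> y \<in> S"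

locale semiring_ideal = carrier_semiring R for I and R (structure) +
  assumes ideal_subset: "I \<subseteq> carrier R"
    and ideal_nonempty: "I \<noteq> {}"
    and ideal_add: "\<lbrakk>x \<in> I; y \<in> I\<rbrakk> \<Longrightarrow> x \<oplus> y \<in> I"
    and ideal_mult_left: "\<lbrakk>r \<in> carrier R; x \<in> I\<rbrakk> \<Longrightarrow> r \<otimes> x \<in> I"
    and ideal_mult_right: "\<lbrakk>x \<in> I; r \<in> carrier R\<rbrakk> \<Longrightarrow> x \<otimes> r \<in> I"

locale maximal_semiring_ideal = semiring_ideal I R for I and R (structure) +
  assumes proper: "I \<noteq> carrier R"
    and maximal: "\<not> (\<exists>J. semiring_ideal J R \<and> I \<subset> J \<and> J \<subset> carrier R)"


section \<open>The lattices with a bottom, a top and pairwise incomparable atoms\<close>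

text \<open>The type is the lattice with countably many atoms; the finite lattices in question are its
  sublattices \<open>lozenge n\<close> below.\<close>

datatype diamond = Zero | One | Atom nat

instantiation diamond :: bounded_lattice
begin

definition less_eq_diamond :: "diamond \<Rightarrow> diamond \<Rightarrow> bool" where
  "x \<le> y \<longleftrightarrow> x = Zero \<or> y = One \<or> x = y"

definition less_diamond :: "diamond \<Rightarrow> diamond \<Rightarrow> bool" where
  "x < y \<longleftrightarrow> x \<le> y \<and> x \<noteq> (y :: diamond)"

definition bot_diamond :: diamond where "bot = Zero"

definition top_diamond :: diamond where "top = One"

definition sup_diamond :: "diamond \<Rightarrow> diamond \<Rightarrow> diamond" where
  "sup x y = (if x \<le> y then y else if y \<le> x then x else One)"

definition inf_diamond :: "diamond \<Rightarrow> diamond \<Rightarrow> diamond" where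
  "inf x y = (if x \<le> y then x else if y \<le> x then y else Zero)"

instance
  by standard
    (auto simp: less_eq_diamond_def less_diamond_def bot_diamond_def top_diamond_def
      sup_diamond_def inf_diamond_def)

end

definition lozenge :: "nat \<Rightarrow> diamond set" where
  "lozenge n = {bot, top} \<union> Atom ` {1..n - 2}"

lemma card_lozenge: "n \<ge> 2 \<Longrightarrow> card (lozenge n) = n"
proof -
  assume "n \<ge> 2"
  have "card (Atom ` {1..n - 2}) = n - 2"
    by (simp add: card_image inj_on_def)
  moreover have "lozenge n = insert Zero (insert One (Atom ` {1..n - 2}))"
    by (simp add: lozenge_def bot_diamond_def top_diamond_def)
  moreover have "Zero \<notin> insert One (Atom ` {1..n - 2})" "One \<notin> Atom ` {1..n - 2}"
    by auto
  ultimately show ?thesis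
    using \<open>n \<ge> 2\<close> by simp
qed


section \<open>The endomorphism semiring\<close>

text \<open>Maps on \<open>lozenge n\<close> are extensional functions, so that equality of maps is pointwise equality
  on \<open>lozenge n\<close>. Multiplication is composition from left to right: \<open>\<alpha> \<otimes> \<beta>\<close> applies \<open>\<alpha>\<close> first.\<close>

definition End_lozenge :: "nat \<Rightarrow> (diamond \<Rightarrow> diamond) semiring_struct" where
  "End_lozenge n =
    \<lparr>carrier = {\<alpha> \<in> lozenge n \<rightarrow>\<^sub>E lozenge n.
        (\<forall>x\<in>lozenge n. \<forall>y\<in>lozenge n. \<alpha> (sup x y) = sup (\<alpha> x) (\<alpha> y)) \<and> \<alpha> bot = bot},
     add = (\<lambda>\<alpha> \<beta>. \<lambda>x\<in>lozenge n. sup (\<alpha> x) (\<beta> x)),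
     mult = (\<lambda>\<alpha> \<beta>. \<lambda>x\<in>lozenge n. \<beta> (\<alpha> x))\<rparr>"

definition identity_map :: "nat \<Rightarrow> diamond \<Rightarrow> diamond" where
  "identity_map n = (\<lambda>x\<in>lozenge n. x)"

definition stable_idempotents :: "nat \<Rightarrow> (diamond \<Rightarrow> diamond) set" where
  "stable_idempotents n =
    {\<alpha> \<in> carrier (End_lozenge n). \<alpha> \<otimes>\<^bsub>End_lozenge n\<^esub> \<alpha> = \<alpha> \<and> \<alpha> top = top}"

definition SI :: "nat \<Rightarrow> (diamond \<Rightarrow> diamond) semiring_struct" where
  "SI n = (End_lozenge n)\<lparr>carrier := stable_idempotents n\<rparr>"

definition one_bar :: "nat \<Rightarrow> diamond \<Rightarrow> diamond" where
  "one_bar n = (\<lambda>x\<in>lozenge n. if x = bot then bot else top)"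

definition phi :: "nat \<Rightarrow> nat \<Rightarrow> diamond \<Rightarrow> diamond" where
  "phi n j = (\<lambda>x\<in>lozenge n. if x = bot \<or> x = Atom j then bot else top)"

definition End_01_star :: "nat \<Rightarrow> (diamond \<Rightarrow> diamond) set" where
  "End_01_star n = {one_bar n} \<union> phi n ` {1..n - 2}"

end

theory Submission
  imports Defs
begin

text \<open>
  If \<open>\<alpha>\<close> fixes the top, then two distinct atoms have images with join \<open>1\<close>. Hence either some
  \<open>a\<^sub>j\<close> is sent to \<open>0\<close> and \<open>\<alpha> = \<phi>\<^sub>j\<close>, or distinct atoms sent to atoms have distinct images; in
  the latter case idempotency forces every atom to be fixed or sent to \<open>1\<close>. The stable idempotents
  are therefore the \<open>\<phi>\<^sub>j\<close> together with the partial identities \<open>\<iota>\<^sub>S\<close>, where \<open>S\<close> is the set of fixed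
  atoms, and the assertions are read off their addition and multiplication tables. The complement of
  a single element is maximal as soon as it is an ideal.
\<close>

section \<open>Passing to subsemirings, and complements of a point\<close>

lemma subsemiring_imp_carrier_semiring:
  assumes "subsemiring S R"
  shows "carrier_semiring (R\<lparr>carrier := S\<rparr>)"
proof -
  interpret subsemiring S R by fact
  \<comment> \<open>The laws are inherited from the larger carrier; closure is supplied by
    \<open>sub_add\<close> and \<open>sub_mult\<close>.\<close>
  have in_carrier: "x \<in> carrier R" if "x \<in> S" for x
    using that sub_subset by blast
  show ?thesis
    by unfold_locales
      (simp_all add: in_carrier sub_add sub_mult add_assoc mult_assoc distrib_left distrib_right,
        simp add: in_carrier add_comm)
qed

text \<open>No set at all lies strictly between \<open>carrier R - {x}\<close> and
  \<open>carrier R\<close>, and membership of \<open>x\<close> makes the complement proper.\<close>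

lemma maximal_semiring_ideal_remove1:
  assumes "semiring_ideal (carrier R - {x}) R" and "x \<in> carrier R"
  shows "maximal_semiring_ideal (carrier R - {x}) R"
  using assms by (intro maximal_semiring_ideal.intro maximal_semiring_ideal_axioms.intro) auto

section \<open>Computing joins on constructors\<close>

lemma sup_diamond_simps [simp]:
  "sup Zero x = x" "sup x Zero = x" "sup One x = One" "sup x One = One"
  "sup (Atom i) (Atom j) = (if i = j then Atom i else One)"
  by (cases x; simp add: sup_diamond_def less_eq_diamond_def)+

lemma bot_diamond [simp]: "bot = Zero" and top_diamond [simp]: "top = One"
  by (simp_all add: bot_diamond_def top_diamond_def)

lemma Zero_in_lozenge [simp]: "Zero \<in> lozenge n"
  and One_in_lozenge [simp]: "One \<in> lozenge n"
  and Atom_in_lozenge [simp]: "Atom i \<in> lozenge n \<longleftrightarrow> i \<in> {1..n - 2}"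
  by (auto simp: lozenge_def)

lemma sup_in_lozenge [simp]: "x \<in> lozenge n \<Longrightarrow> y \<in> lozenge n \<Longrightarrow> sup x y \<in> lozenge n"
  by (cases x; cases y) auto

text \<open>Used to see that the pointwise join of two join-preserving maps again preserves
  joins.\<close>

lemma sup_sup_swap: "sup (sup a b) (sup c d) = sup (sup a c) (sup b d)"
  for a :: "'a :: semilattice_sup"
  by (simp add: ac_simps)

section \<open>The endomorphism semiring\<close>

lemma carrier_End_lozenge: "\<alpha> \<in> carrier (End_lozenge n) \<longleftrightarrow>
    \<alpha> \<in> lozenge n \<rightarrow>\<^sub>E lozenge n \<and> \<alpha> Zero = Zero \<and>
    (\<forall>x\<in>lozenge n. \<forall>y\<in>lozenge n. \<alpha> (sup x y) = sup (\<alpha> x) (\<alpha> y))"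
  by (auto simp: End_lozenge_def)

lemma add_End_lozenge: "\<alpha> \<oplus>\<^bsub>End_lozenge n\<^esub> \<beta> = (\<lambda>x\<in>lozenge n. sup (\<alpha> x) (\<beta> x))"
  and mult_End_lozenge: "\<alpha> \<otimes>\<^bsub>End_lozenge n\<^esub> \<beta> = (\<lambda>x\<in>lozenge n. \<beta> (\<alpha> x))"
  by (simp_all add: End_lozenge_def)

lemma carrier_semiring_End_lozenge: "carrier_semiring (End_lozenge n)"
proof
  fix \<alpha> \<beta> \<gamma>
  assume \<alpha>: "\<alpha> \<in> carrier (End_lozenge n)" and \<beta>: "\<beta> \<in> carrier (End_lozenge n)"
  then have \<alpha>\<beta>: "\<alpha> x \<in> lozenge n" "\<beta> x \<in> lozenge n"
      "y \<in> lozenge n \<Longrightarrow> \<alpha> (sup x y) = sup (\<alpha> x) (\<alpha> y)"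
      "y \<in> lozenge n \<Longrightarrow> \<beta> (sup x y) = sup (\<beta> x) (\<beta> y)" if "x \<in> lozenge n" for x y
    using that by (auto simp: carrier_End_lozenge PiE_iff)
  have Zero: "\<alpha> Zero = Zero" "\<beta> Zero = Zero"
    using \<alpha> \<beta> by (auto simp: carrier_End_lozenge)
  show "\<alpha> \<oplus>\<^bsub>End_lozenge n\<^esub> \<beta> \<in> carrier (End_lozenge n)"
    using \<alpha>\<beta>(1,2) Zero
    by (auto simp: carrier_End_lozenge add_End_lozenge \<alpha>\<beta>(3,4) sup_sup_swap)
  show "\<alpha> \<otimes>\<^bsub>End_lozenge n\<^esub> \<beta> \<in> carrier (End_lozenge n)"
    using \<alpha>\<beta> Zero by (auto simp: carrier_End_lozenge mult_End_lozenge)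
  show "\<alpha> \<oplus>\<^bsub>End_lozenge n\<^esub> \<beta> = \<beta> \<oplus>\<^bsub>End_lozenge n\<^esub> \<alpha>"
    by (simp add: add_End_lozenge sup_commute)
  assume "\<gamma> \<in> carrier (End_lozenge n)"
  \<comment> \<open>The right distributive law applies \<open>\<gamma>\<close> to a join and
    therefore rests on this; the left one is the pointwise definition of addition, read at the point
    \<open>\<alpha> x\<close>.\<close>
  then have \<gamma>: "\<gamma> (sup x y) = sup (\<gamma> x) (\<gamma> y)" if "x \<in> lozenge n" "y \<in> lozenge n" for x y
    using that by (simp add: carrier_End_lozenge)
  show "\<alpha> \<oplus>\<^bsub>End_lozenge n\<^esub> \<beta> \<oplus>\<^bsub>End_lozenge n\<^esub> \<gamma> = \<alpha> \<oplus>\<^bsub>End_lozenge n\<^esub> (\<beta> \<oplus>\<^bsub>End_lozenge n\<^esub> \<gamma>)"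
    by (auto simp: add_End_lozenge sup_assoc intro!: restrict_ext)
  show "\<alpha> \<otimes>\<^bsub>End_lozenge n\<^esub> \<beta> \<otimes>\<^bsub>End_lozenge n\<^esub> \<gamma> = \<alpha> \<otimes>\<^bsub>End_lozenge n\<^esub> (\<beta> \<otimes>\<^bsub>End_lozenge n\<^esub> \<gamma>)"
    using \<alpha>\<beta> by (auto simp: mult_End_lozenge intro!: restrict_ext)
  show "\<alpha> \<otimes>\<^bsub>End_lozenge n\<^esub> (\<beta> \<oplus>\<^bsub>End_lozenge n\<^esub> \<gamma>)
      = \<alpha> \<otimes>\<^bsub>End_lozenge n\<^esub> \<beta> \<oplus>\<^bsub>End_lozenge n\<^esub> \<alpha> \<otimes>\<^bsub>End_lozenge n\<^esub> \<gamma>"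
    using \<alpha>\<beta> by (auto simp: add_End_lozenge mult_End_lozenge intro!: restrict_ext)
  show "(\<alpha> \<oplus>\<^bsub>End_lozenge n\<^esub> \<beta>) \<otimes>\<^bsub>End_lozenge n\<^esub> \<gamma>
      = \<alpha> \<otimes>\<^bsub>End_lozenge n\<^esub> \<gamma> \<oplus>\<^bsub>End_lozenge n\<^esub> \<beta> \<otimes>\<^bsub>End_lozenge n\<^esub> \<gamma>"
    using \<alpha>\<beta> \<gamma> by (auto simp: add_End_lozenge mult_End_lozenge intro!: restrict_ext)
qed

section \<open>The two families of maps\<close>

definition partial_identity :: "nat \<Rightarrow> nat set \<Rightarrow> diamond \<Rightarrow> diamond" where
  "partial_identity n S = (\<lambda>x\<in>lozenge n. if x = Zero \<or> x \<in> Atom ` S then x else One)"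

text \<open>The partial identities run from \<open>one_bar n\<close> at the empty index set to the
  identity at the full one. Putting both into one family turns sums and products into intersections
  of index sets.\<close>

lemma one_bar_eq: "one_bar n = partial_identity n {}"
  by (auto simp: one_bar_def partial_identity_def intro!: restrict_ext)

lemma identity_map_eq: "identity_map n = partial_identity n {1..n - 2}"
  by (auto simp: identity_map_def partial_identity_def lozenge_def intro!: restrict_ext)

lemma lozenge_fun_eqI:
  assumes "f \<in> extensional (lozenge n)" "g \<in> extensional (lozenge n)"
    and "f Zero = g Zero" "f One = g One" "\<And>i. i \<in> {1..n - 2} \<Longrightarrow> f (Atom i) = g (Atom i)"
  shows "f = g"
  using assms(1,2)
proof (rule extensionalityI)
  show "f x = g x" if "x \<in> lozenge n" for x
    using that assms(3-5) by (cases x) auto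
qed

lemma phi_apply [simp]:
  "phi n j Zero = Zero" "phi n j One = One"
  "i \<in> {1..n - 2} \<Longrightarrow> phi n j (Atom i) = (if i = j then Zero else One)"
  by (simp_all add: phi_def)

lemma partial_identity_apply [simp]:
  "partial_identity n S Zero = Zero" "partial_identity n S One = One"
  "i \<in> {1..n - 2} \<Longrightarrow> partial_identity n S (Atom i) = (if i \<in> S then Atom i else One)"
  by (auto simp: partial_identity_def)

lemma extensional_lozenge_maps [simp]:
  "phi n j \<in> extensional (lozenge n)" "partial_identity n S \<in> extensional (lozenge n)"
  by (simp_all add: phi_def partial_identity_def)

section \<open>Addition and multiplication tables\<close>

lemma phi_add_phi: "phi n i \<oplus>\<^bsub>End_lozenge n\<^esub> phi n j =
    (if i = j then phi n i else partial_identity n {})"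
  by (rule lozenge_fun_eqI) (auto simp: add_End_lozenge)

text \<open>An atom not fixed by one of the summands is sent to \<open>One\<close> there, and
  \<open>One\<close> absorbs in a join.\<close>

lemma partial_identity_add_partial_identity:
  "partial_identity n S \<oplus>\<^bsub>End_lozenge n\<^esub> partial_identity n T = partial_identity n (S \<inter> T)"
  by (rule lozenge_fun_eqI) (auto simp: add_End_lozenge)

text \<open>At every atom other than \<open>Atom j\<close> the value \<open>One\<close> of
  \<open>phi n j\<close> absorbs; at \<open>Atom j\<close> its value \<open>Zero\<close> leaves the
  other summand unchanged.\<close>

lemma phi_add_partial_identity:
  "phi n j \<oplus>\<^bsub>End_lozenge n\<^esub> partial_identity n S = partial_identity n (S \<inter> {j})"
  "partial_identity n S \<oplus>\<^bsub>End_lozenge n\<^esub> phi n j = partial_identity n (S \<inter> {j})"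
  by (rule lozenge_fun_eqI; auto simp: add_End_lozenge)+

text \<open>All values of \<open>phi n j\<close> are \<open>Zero\<close> or \<open>One\<close>, and
  \<open>\<alpha>\<close> fixes both.\<close>

lemma phi_mult:
  "\<lbrakk>\<alpha> Zero = Zero; \<alpha> One = One\<rbrakk> \<Longrightarrow> phi n j \<otimes>\<^bsub>End_lozenge n\<^esub> \<alpha> = phi n j"
  by (rule lozenge_fun_eqI) (auto simp: mult_End_lozenge)

lemma partial_identity_mult_partial_identity:
  "partial_identity n S \<otimes>\<^bsub>End_lozenge n\<^esub> partial_identity n T = partial_identity n (S \<inter> T)"
  by (rule lozenge_fun_eqI) (auto simp: mult_End_lozenge)

text \<open>Only \<open>Atom j\<close> can be sent to \<open>Zero\<close>, and this happens exactly
  when the first factor leaves it in place instead of raising it to \<open>One\<close>.\<close>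

lemma partial_identity_mult_phi:
  "partial_identity n S \<otimes>\<^bsub>End_lozenge n\<^esub> phi n j =
    (if j \<in> S then phi n j else partial_identity n {})"
  by (rule lozenge_fun_eqI) (auto simp: mult_End_lozenge)

lemmas End_lozenge_tables =
  phi_add_phi partial_identity_add_partial_identity phi_add_partial_identity
  phi_mult partial_identity_mult_partial_identity partial_identity_mult_phi

lemma phi_in_End_lozenge: "phi n j \<in> carrier (End_lozenge n)"
  unfolding carrier_End_lozenge PiE_iff
  by (auto simp: lozenge_def phi_def)

lemma partial_identity_in_End_lozenge: "partial_identity n S \<in> carrier (End_lozenge n)"
  unfolding carrier_End_lozenge PiE_iff
  by (auto simp: lozenge_def partial_identity_def)

section \<open>Classification of the stable idempotents\<close>

lemma stable_idempotent_cases: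
  assumes "n \<ge> 4" and "\<alpha> \<in> stable_idempotents n"
  obtains (phi) j where "j \<in> {1..n - 2}" "\<alpha> = phi n j"
  | (partial_identity) S where "S \<subseteq> {1..n - 2}" "\<alpha> = partial_identity n S"
proof -
  have ext: "\<alpha> \<in> extensional (lozenge n)"
    and range: "\<And>x. x \<in> lozenge n \<Longrightarrow> \<alpha> x \<in> lozenge n"
    and Zero: "\<alpha> Zero = Zero" and One: "\<alpha> One = One"
    and sup: "\<And>x y. \<lbrakk>x \<in> lozenge n; y \<in> lozenge n\<rbrakk> \<Longrightarrow> \<alpha> (sup x y) = sup (\<alpha> x) (\<alpha> y)"
    and idem: "\<alpha> \<otimes>\<^bsub>End_lozenge n\<^esub> \<alpha> = \<alpha>"
    using assms(2) by (auto simp: stable_idempotents_def carrier_End_lozenge PiE_iff)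
  have idem: "\<alpha> (\<alpha> x) = \<alpha> x" if "x \<in> lozenge n" for x
    using fun_cong[OF idem, of x] that by (simp add: mult_End_lozenge)
  have join: "sup (\<alpha> (Atom i)) (\<alpha> (Atom j)) = One"
    if "i \<in> {1..n - 2}" "j \<in> {1..n - 2}" "i \<noteq> j" for i j
    using sup[of "Atom i" "Atom j"] that One by simp
  show thesis
  proof (cases "\<exists>j\<in>{1..n - 2}. \<alpha> (Atom j) = Zero")
    case True
    then obtain j where j: "j \<in> {1..n - 2}" "\<alpha> (Atom j) = Zero" by blast
    \<comment> \<open>The image of any other atom has join \<open>One\<close> with \<alpha> (Atom j)
      = Zero, so it is itself \<open>One\<close>.\<close>
    have "\<alpha> = phi n j"
      using j join[of j] ext Zero One by (intro lozenge_fun_eqI) auto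
    with j(1) show thesis by (rule phi)
  next
    case False
    have fixed: "\<alpha> (Atom i) \<in> {Atom i, One}" if i: "i \<in> {1..n - 2}" for i
    proof (cases "\<alpha> (Atom i)")
      case (Atom k)
      then have "k \<in> {1..n - 2}" "\<alpha> (Atom k) = Atom k"
        using range[of "Atom i"] idem[of "Atom i"] i by auto
      \<comment> \<open>If k \<noteq> i, the distinct atoms \<open>Atom i\<close> and
        \<open>Atom k\<close> would share the image \<open>Atom k\<close>, whose join with itself is
        not \<open>One\<close>.\<close>
      then show ?thesis using join[of i k] i Atom by auto
    qed (use False i in auto)
    let ?S = "{i \<in> {1..n - 2}. \<alpha> (Atom i) = Atom i}"
    have "\<alpha> = partial_identity n ?S"
    proof (rule lozenge_fun_eqI[OF ext])
      show "\<alpha> (Atom i) = partial_identity n ?S (Atom i)" if "i \<in> {1..n - 2}" for i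
        using fixed[OF that] that by auto
    qed (simp_all add: Zero One)
    then show thesis by (intro partial_identity[of ?S]) auto
  qed
qed

lemma stable_idempotents_eq:
  assumes "n \<ge> 4"
  shows "stable_idempotents n = phi n ` {1..n - 2} \<union> partial_identity n ` Pow {1..n - 2}"
proof
  show "stable_idempotents n \<subseteq> phi n ` {1..n - 2} \<union> partial_identity n ` Pow {1..n - 2}"
    using stable_idempotent_cases[OF assms] by blast
  \<comment> \<open>Idempotency is the diagonal of the multiplication tables.\<close>
  show "phi n ` {1..n - 2} \<union> partial_identity n ` Pow {1..n - 2} \<subseteq> stable_idempotents n"
    by (auto simp: stable_idempotents_def phi_in_End_lozenge partial_identity_in_End_lozenge
        End_lozenge_tables)
qed

lemma End_01_star_eq: "End_01_star n = insert (partial_identity n {}) (phi n ` {1..n - 2})"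
  by (simp add: End_01_star_def one_bar_eq)

section \<open>The subsemiring and its ideals\<close>

lemma subsemiring_stable_idempotents:
  assumes "n \<ge> 4"
  shows "subsemiring (stable_idempotents n) (End_lozenge n)"
proof (intro subsemiring.intro subsemiring_axioms.intro carrier_semiring_End_lozenge)
  show "stable_idempotents n \<subseteq> carrier (End_lozenge n)"
    by (auto simp: stable_idempotents_def)
\<comment> \<open>Idempotency is not checked again for sums and products: every table entry already
  belongs to one of the two classified families.\<close>
qed (auto simp: stable_idempotents_eq[OF assms] End_lozenge_tables simp del: atLeastAtMost_iff)

lemma SI_simps [simp]:
  "carrier (SI n) = stable_idempotents n"
  "\<alpha> \<oplus>\<^bsub>SI n\<^esub> \<beta> = \<alpha> \<oplus>\<^bsub>End_lozenge n\<^esub> \<beta>" "\<alpha> \<otimes>\<^bsub>SI n\<^esub> \<beta> = \<alpha> \<otimes>\<^bsub>End_lozenge n\<^esub> \<beta>"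
  by (simp_all add: SI_def)

lemma carrier_semiring_SI: "n \<ge> 4 \<Longrightarrow> carrier_semiring (SI n)"
  unfolding SI_def by (intro subsemiring_imp_carrier_semiring subsemiring_stable_idempotents)

text \<open>The \<open>phi n j\<close> absorb every right factor, a left factor
  \<open>partial_identity n S\<close> yields \<open>phi n j\<close> or \<open>one_bar n\<close>, and
  intersecting with the empty index set keeps it empty.\<close>

lemma semiring_ideal_End_01_star:
  assumes "n \<ge> 4"
  shows "semiring_ideal (End_01_star n) (SI n)"
  by (intro semiring_ideal.intro semiring_ideal_axioms.intro carrier_semiring_SI[OF assms])
    (auto simp: stable_idempotents_eq[OF assms] End_01_star_eq End_lozenge_tables)

text \<open>Within the index range, \<open>S\<close> is recovered as the set of indices of fixed
  atoms.\<close>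

lemma partial_identity_eq_identity_map_iff:
  assumes "S \<subseteq> {1..n - 2}"
  shows "partial_identity n S = identity_map n \<longleftrightarrow> S = {1..n - 2}"
proof
  assume eq: "partial_identity n S = identity_map n"
  have "i \<in> S" if "i \<in> {1..n - 2}" for i
    using fun_cong[OF eq, of "Atom i"] that by (simp add: identity_map_eq split: if_splits)
  with assms show "S = {1..n - 2}" by blast
qed (simp add: identity_map_eq)

lemma phi_neq_identity_map:
  assumes "j \<in> {1..n - 2}"
  shows "phi n j \<noteq> identity_map n"
  using assms by (auto simp: identity_map_eq dest!: fun_cong[of _ _ "Atom j"])

text \<open>The identity has the full index set, which no relevant table entry produces:
  intersecting with a proper subset stays proper, and a product with some \<open>phi n j\<close> is
  that map or has empty index set.\<close>

lemma semiring_ideal_SI_minus_identity_map: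
  assumes "n \<ge> 4"
  shows "semiring_ideal (stable_idempotents n - {identity_map n}) (SI n)"
proof -
  define A where "A = {1..n - 2}"
  \<comment> \<open>Two atoms are available because n \<ge> 4; hence the sum of
    \<open>phi n j\<close> and a partial identity, which fixes at most one atom, is not the
    identity.\<close>
  have "1 \<in> A" "2 \<in> A" using assms by (auto simp: A_def)
  then have small: "S \<inter> {j} \<subset> A" if "S \<subseteq> A" for S j
    using that by force
  have SI_eq: "stable_idempotents n = phi n ` A \<union> partial_identity n ` Pow A"
    using stable_idempotents_eq[OF assms] by (simp add: A_def)
  \<comment> \<open>Removing the identity leaves all \<open>phi n j\<close> and exactly the partial
    identities with proper index set.\<close>
  have "phi n ` A - {identity_map n} = phi n ` A"
    using phi_neq_identity_map unfolding A_def by (intro Diff_triv) blast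
  moreover have "partial_identity n ` Pow A - {identity_map n} = partial_identity n ` {S. S \<subset> A}"
  proof (intro Set.set_eqI iffI)
    fix \<alpha> assume "\<alpha> \<in> partial_identity n ` Pow A - {identity_map n}"
    then obtain S where S: "S \<subseteq> A" "\<alpha> = partial_identity n S" "\<alpha> \<noteq> identity_map n" by blast
    then have "S \<noteq> A" by (auto simp: A_def identity_map_eq)
    with S show "\<alpha> \<in> partial_identity n ` {S. S \<subset> A}" by blast
  next
    fix \<alpha> assume "\<alpha> \<in> partial_identity n ` {S. S \<subset> A}"
    then obtain S where S: "S \<subset> A" "\<alpha> = partial_identity n S" by blast
    then have "\<alpha> \<noteq> identity_map n"
      using partial_identity_eq_identity_map_iff[of S n] by (auto simp: A_def)
    with S show "\<alpha> \<in> partial_identity n ` Pow A - {identity_map n}" by blast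
  qed
  ultimately have eq: "stable_idempotents n - {identity_map n} =
      phi n ` A \<union> partial_identity n ` {S. S \<subset> A}"
    unfolding SI_eq Un_Diff by simp
  have small': "S \<inter> {j} \<subset> A" if "S \<subset> A" for S j
    using small that by blast
  have inter: "S \<inter> T \<subset> A" "T \<inter> S \<subset> A" if "S \<subset> A" for S T
    using that by blast+
  have empty: "{} \<subset> A" using \<open>1 \<in> A\<close> by blast
  let ?I = "phi n ` A \<union> partial_identity n ` {S. S \<subset> A}"
  have "semiring_ideal ?I (SI n)"
  proof (intro semiring_ideal.intro semiring_ideal_axioms.intro carrier_semiring_SI[OF assms])
    show "?I \<subseteq> carrier (SI n)"
      unfolding SI_simps SI_eq by blast
    show "?I \<noteq> {}"
      using empty by blast
  next
    fix \<alpha> \<beta> assume "\<alpha> \<in> ?I" "\<beta> \<in> ?I"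
    then show "\<alpha> \<oplus>\<^bsub>SI n\<^esub> \<beta> \<in> ?I"
      by (elim UnE imageE; simp add: End_lozenge_tables small' inter empty)
  next
    fix \<rho> \<alpha> assume "\<rho> \<in> carrier (SI n)" "\<alpha> \<in> ?I"
    then show "\<rho> \<otimes>\<^bsub>SI n\<^esub> \<alpha> \<in> ?I" "\<alpha> \<otimes>\<^bsub>SI n\<^esub> \<rho> \<in> ?I"
      unfolding SI_simps SI_eq
      by (elim UnE imageE; simp add: End_lozenge_tables inter empty)+
  qed
  then show ?thesis
    by (simp only: eq)
qed

theorem proposition6p2:
  fixes n :: nat
  assumes "n \<ge> 4"
  shows "subsemiring (stable_idempotents n) (End_lozenge n) \<and>
    semiring_ideal (End_01_star n) (SI n) \<and>
    maximal_semiring_ideal (stable_idempotents n - {identity_map n}) (SI n)"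
proof (intro conjI)
  have "identity_map n \<in> stable_idempotents n"
    by (simp add: stable_idempotents_eq[OF assms] identity_map_eq)
  then show "maximal_semiring_ideal (stable_idempotents n - {identity_map n}) (SI n)"
    using maximal_semiring_ideal_remove1[of "SI n" "identity_map n"]
      semiring_ideal_SI_minus_identity_map[OF assms] by simp
qed (fact subsemiring_stable_idempotents[OF assms] semiring_ideal_End_01_star[OF assms])+

end
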